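(* Let $p\ge0$, $C_A\ge1$, $C_\kappa\ge0$. There is a constant $C>0$, depending only on $p$, $C_A$ and $C_\kappa$, such that the following holds. Let $D\ge2$, $\delta>0$, let $\lambda_1\ge\cdots\ge\lambda_D>0$ satisfy $C_A^{-1}i^{-p}\le\lambda_i\le C_Ai^{-p}$ for $1\le i\le D$, assume $|\kappa-D\delta^2|\le C_\kappa\sqrt D\,\delta^2$ and choose $m_0=\lfloor\sqrt D\rfloor+1$. Then for all $(\beta,R)$, $\beta\ge0$, $R>0$, with $t_{\beta,p,R}(\delta)\in[\sqrt D,D]$, $$\sup_{\mu\in H^\beta(R,D)}\mathbb{E}_\mu\big[\|\widehat\mu^{(\tau)}-\mu\|^2\big]\le C\,\mathcal R^*_{\beta,p,R}(\delta)^2.$$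
   Context: Model: for a signal $\mu\in\mathbb{R}^D$ one observes $Y_i=\lambda_i\mu_i+\delta\varepsilon_i$, $i=1,\ldots,D$, with $\varepsilon_i$ independent $N(0,1)$; $\mathbb{E}_\mu$ is expectation under signal $\mu$; $\|\cdot\|$ is the Euclidean norm. Truncated SVD estimators: $\widehat\mu^{(m)}_i=\mathbf 1(i\le m)\lambda_i^{-1}Y_i$, $0\le m\le D$. Residuals: $R_m^2=\sum_{i=m+1}^DY_i^2$. Given the starting index $m_0$ and threshold $\kappa>0$, the stopping rule is $\tau=\min\{m\in\{m_0,\ldots,D\}:R_m^2\le\kappa\}$. Sobolev-type ellipsoids: $H^\beta(R,D)=\{\mu\in\mathbb{R}^D:\sum_{i=1}^Di^{2\beta}\mu_i^2\le R^2\}$. Notation: $t_{\beta,p,R}(\delta)=(R^{-1}\delta)^{-2/(2\beta+2p+1)}$ and $\mathcal R^*_{\beta,p,R}(\delta)=R(R^{-1}\delta)^{2\beta/(2\beta+2p+1)}$. *)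

theory Defs
  imports "HOL-Probability.Probability"
begin

text \<open>
  A vector of \<open>\<real>\<^sup>D\<close> is a function in \<open>{1..D} \<rightarrow>\<^sub>E UNIV\<close>, i.e. indexed by \<open>1, \<dots>, D\<close> and
  \<open>undefined\<close> elsewhere.
\<close>

definition std_normal_noise :: "nat \<Rightarrow> (nat \<Rightarrow> real) measure" where
  "std_normal_noise D = (\<Pi>\<^sub>M i\<in>{1..D}. density lborel (\<lambda>x. ennreal (std_normal_density x)))"

text \<open>
  Expectations below are taken on this canonical noise space. This loses no generality: the
  noise vector has the same law on every probability space carrying it.
\<close>

lemma distr_eq_std_normal_noise:
  assumes "prob_space M" and "D \<ge> 1"
    and indep: "prob_space.indep_vars M (\<lambda>_. borel) \<epsilon> {1..D}"
    and normal: "\<And>i. i \<in> {1..D} \<Longrightarrow> distributed M lborel (\<epsilon> i) (\<lambda>x. ennreal (std_normal_density x))"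
  shows "distr M (\<Pi>\<^sub>M i\<in>{1..D}. borel) (\<lambda>\<omega>. \<lambda>i\<in>{1..D}. \<epsilon> i \<omega>) = std_normal_noise D"
proof -
  interpret prob_space M by fact
  have rv: "random_variable borel (\<epsilon> i)" if "i \<in> {1..D}" for i
    using distributed_measurable[OF normal[OF that]] by simp
  have ne: "{1..D} \<noteq> {}" using \<open>D \<ge> 1\<close> by simp
  have "distr M borel (\<epsilon> i) = density lborel (\<lambda>x. ennreal (std_normal_density x))" if "i \<in> {1..D}" for i
  proof -
    have "distr M borel (\<epsilon> i) = distr M lborel (\<epsilon> i)"
      by (rule distr_cong) auto
    then show ?thesis using distributed_distr_eq_density[OF normal[OF that]] by simp
  qed
  then have "(\<Pi>\<^sub>M i\<in>{1..D}. distr M borel (\<epsilon> i)) = std_normal_noise D"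
    unfolding std_normal_noise_def by (intro PiM_cong) auto
  moreover have "distr M (\<Pi>\<^sub>M i\<in>{1..D}. borel) (\<lambda>\<omega>. \<lambda>i\<in>{1..D}. \<epsilon> i \<omega>)
      = (\<Pi>\<^sub>M i\<in>{1..D}. distr M borel (\<epsilon> i))"
    using indep_vars_iff_distr_eq_PiM'[where X = \<epsilon> and M' = "\<lambda>_. borel", OF ne rv] indep by blast
  ultimately show ?thesis by (rule trans[rotated])
qed

definition observation ::
  "nat \<Rightarrow> (nat \<Rightarrow> real) \<Rightarrow> real \<Rightarrow> (nat \<Rightarrow> real) \<Rightarrow> (nat \<Rightarrow> real) \<Rightarrow> (nat \<Rightarrow> real)" where
  "observation D lam \<delta> \<mu> \<epsilon> = (\<lambda>i\<in>{1..D}. lam i * \<mu> i + \<delta> * \<epsilon> i)"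

text \<open>
  The expectation of a nonnegative functional of the observations, with values in
  \<open>[0, \<infinity>]\<close> (so a non-integrable functional has expectation \<open>\<infinity>\<close>, not \<open>0\<close>).
\<close>

definition expectation_under ::
  "nat \<Rightarrow> (nat \<Rightarrow> real) \<Rightarrow> real \<Rightarrow> (nat \<Rightarrow> real) \<Rightarrow> ((nat \<Rightarrow> real) \<Rightarrow> real) \<Rightarrow> ennreal" where
  "expectation_under D lam \<delta> \<mu> F =
     (\<integral>\<^sup>+ \<epsilon>. ennreal (F (observation D lam \<delta> \<mu> \<epsilon>)) \<partial>std_normal_noise D)"

definition tsvd_estimator ::
  "nat \<Rightarrow> (nat \<Rightarrow> real) \<Rightarrow> nat \<Rightarrow> (nat \<Rightarrow> real) \<Rightarrow> (nat \<Rightarrow> real)" where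
  "tsvd_estimator D lam m Y = (\<lambda>i\<in>{1..D}. if i \<le> m then inverse (lam i) * Y i else 0)"

definition residual_sq :: "nat \<Rightarrow> nat \<Rightarrow> (nat \<Rightarrow> real) \<Rightarrow> real" where
  "residual_sq D m Y = (\<Sum>i = m+1..D. (Y i)\<^sup>2)"

text \<open>The minimum exists if \<open>m\<^sub>0 \<le> D\<close> and \<open>\<kappa> \<ge> 0\<close>, because the residual at \<open>m = D\<close> is \<open>0\<close>.\<close>

definition stopping_index :: "nat \<Rightarrow> nat \<Rightarrow> real \<Rightarrow> (nat \<Rightarrow> real) \<Rightarrow> nat" where
  "stopping_index D m\<^sub>0 \<kappa> Y = Min {m \<in> {m\<^sub>0..D}. residual_sq D m Y \<le> \<kappa>}"

definition sq_dist :: "nat \<Rightarrow> (nat \<Rightarrow> real) \<Rightarrow> (nat \<Rightarrow> real) \<Rightarrow> real" where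
  "sq_dist D x y = (L2_set (\<lambda>i. x i - y i) {1..D})\<^sup>2"

definition sobolev_ellipsoid :: "real \<Rightarrow> real \<Rightarrow> nat \<Rightarrow> (nat \<Rightarrow> real) set" where
  "sobolev_ellipsoid \<beta> R D =
     {\<mu> \<in> {1..D} \<rightarrow>\<^sub>E UNIV. (\<Sum>i = 1..D. real i powr (2 * \<beta>) * (\<mu> i)\<^sup>2) \<le> R\<^sup>2}"

definition minimax_index :: "real \<Rightarrow> real \<Rightarrow> real \<Rightarrow> real \<Rightarrow> real" where
  "minimax_index \<beta> p R \<delta> = (inverse R * \<delta>) powr (- 2 / (2 * \<beta> + 2 * p + 1))"

definition minimax_rate :: "real \<Rightarrow> real \<Rightarrow> real \<Rightarrow> real \<Rightarrow> real" where
  "minimax_rate \<beta> p R \<delta> = R * (inverse R * \<delta>) powr (2 * \<beta> / (2 * \<beta> + 2 * p + 1))"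

end

theory Submission
  imports Defs
begin

text \<open>
  Write \<open>t\<close> for the minimax index. Then \<open>R\<^sup>2 = \<delta>\<^sup>2 t\<^bsup>2\<beta> + 2p + 1\<^esup>\<close>, and the squared rate is
  \<open>\<delta>\<^sup>2 t\<^bsup>2p + 1\<^esup>\<close> (lemma \<open>minimax_rate_square_eq\<close>). The loss at the stopping index \<open>\<tau>\<close> is the sum of
  the lost signal \<open>\<Sum>i>\<tau>. \<mu>\<^sub>i\<^sup>2\<close> and the noise \<open>\<delta>\<^sup>2 \<Sum>i\<le>\<tau>. \<lambda>\<^sub>i\<^sup>-\<^sup>2 \<epsilon>\<^sub>i\<^sup>2\<close>; both have to be of mean at most
  a constant times \<open>\<delta>\<^sup>2 t\<^bsup>2p + 1\<^esup>\<close>. Throughout, \<open>sqrt D \<le> t\<close> says that the fluctuation \<open>sqrt D \<delta>\<^sup>2\<close>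
  of the residual is invisible at the scale \<open>t \<delta>\<^sup>2\<close>.

  For the lost signal, let \<open>T\<close> be \<open>t\<close> rounded up. Beyond \<open>T\<close> the ellipsoid condition suffices. If
  \<open>\<tau> < T\<close>, the residual at \<open>\<tau>\<close> is at most \<open>\<kappa>\<close>. As the noise part of the residual is nearly \<open>D \<delta>\<^sup>2\<close>,
  the energy \<open>\<Sum>i>\<tau>. \<lambda>\<^sub>i\<^sup>2 \<mu>\<^sub>i\<^sup>2\<close> is at most \<open>\<delta>\<^sup>2\<close> times a random variable of mean of order \<open>t\<close>
  (lemmas \<open>small_residual_imp_small_energy\<close> and \<open>mean_le_undershoot_energy\<close>), and dividing by the
  smallest \<open>\<lambda>\<^sub>i\<^sup>2\<close> with \<open>i \<le> T\<close> multiplies it by a quantity of order \<open>t\<^bsup>2p\<^esup>\<close>.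

  For the noise, \<open>\<tau> > m\<close> requires the residual at \<open>m\<close> to exceed \<open>\<kappa>\<close>. Once \<open>m\<close> is a large multiple of
  \<open>t\<close>, this is a large deviation of probability at most \<open>exp (- m\<^sup>2 / (64 D))\<close> (lemma
  \<open>residual_exceeds_threshold_mean_le\<close>). Therefore the terms up to a multiple of \<open>t\<close> contribute the
  order \<open>t\<^bsup>2p + 1\<^esup>\<close>, and the later ones no more than that (lemma \<open>mean_le_stopped_noise\<close>).

  In both parts the loss is bounded pointwise, for every value that \<open>\<tau>\<close> may take, by an expression
  free of \<open>\<tau>\<close>; the means of these expressions all follow from the exponential moments of Gaussian
  quadratic forms (lemma \<open>mean_le_exp_quadratic\<close>).
\<close>

section \<open>Upper bounds for means via measurable majorants\<close>

text \<open>
  Measurability is asked of the majorant only. This makes the predicate closed under pointwise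
  domination, so that a loss at a random index can be replaced by a bound that is free of the index.
\<close>

definition mean_le :: "nat \<Rightarrow> ((nat \<Rightarrow> real) \<Rightarrow> real) \<Rightarrow> real \<Rightarrow> bool" where
  "mean_le D f c \<longleftrightarrow> 0 \<le> c \<and>
    (\<exists>g \<in> borel_measurable (std_normal_noise D).
      (\<forall>\<epsilon>. 0 \<le> g \<epsilon> \<and> f \<epsilon> \<le> g \<epsilon>) \<and> (\<integral>\<^sup>+ \<epsilon>. ennreal (g \<epsilon>) \<partial>std_normal_noise D) \<le> ennreal c)"

lemma prob_space_std_normal: "prob_space (density lborel (\<lambda>x. ennreal (std_normal_density x)))"
  by (rule prob_space_normal_density) simp

lemma prob_space_std_normal_noise: "prob_space (std_normal_noise D)"
  unfolding std_normal_noise_def by (intro prob_space_PiM prob_space_std_normal)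

lemma nn_integral_le_of_mean_le:
  "mean_le D f c \<Longrightarrow> (\<integral>\<^sup>+ \<epsilon>. ennreal (f \<epsilon>) \<partial>std_normal_noise D) \<le> ennreal c"
  unfolding mean_le_def by (meson ennreal_leI nn_integral_mono order_trans)

lemma mean_le_mono:
  assumes "mean_le D f c" "\<And>\<epsilon>. f' \<epsilon> \<le> f \<epsilon>" "c \<le> c'"
  shows "mean_le D f' c'"
proof -
  obtain g where g: "g \<in> borel_measurable (std_normal_noise D)" "\<And>\<epsilon>. 0 \<le> g \<epsilon>" "\<And>\<epsilon>. f \<epsilon> \<le> g \<epsilon>"
    "(\<integral>\<^sup>+ \<epsilon>. ennreal (g \<epsilon>) \<partial>std_normal_noise D) \<le> ennreal c" and "0 \<le> c"
    using assms(1) unfolding mean_le_def by blast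
  moreover have "(\<integral>\<^sup>+ \<epsilon>. ennreal (g \<epsilon>) \<partial>std_normal_noise D) \<le> ennreal c'"
    using g(4) ennreal_leI[OF assms(3)] by (rule order_trans)
  ultimately show ?thesis
    unfolding mean_le_def using assms(2,3) by (meson order_trans)
qed

lemma mean_le_const: "0 \<le> c \<Longrightarrow> mean_le D (\<lambda>_. c) c"
  using prob_space.emeasure_space_1[OF prob_space_std_normal_noise, of D]
  unfolding mean_le_def by (intro conjI bexI[of _ "\<lambda>_. c"]) auto

lemma mean_le_add:
  assumes "mean_le D f c" "mean_le D f' c'"
  shows "mean_le D (\<lambda>\<epsilon>. f \<epsilon> + f' \<epsilon>) (c + c')"
proof -
  obtain g where g: "g \<in> borel_measurable (std_normal_noise D)" "\<And>\<epsilon>. 0 \<le> g \<epsilon>" "\<And>\<epsilon>. f \<epsilon> \<le> g \<epsilon>"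
    "(\<integral>\<^sup>+ \<epsilon>. ennreal (g \<epsilon>) \<partial>std_normal_noise D) \<le> ennreal c" and c: "0 \<le> c"
    using assms(1) unfolding mean_le_def by blast
  obtain h where h: "h \<in> borel_measurable (std_normal_noise D)" "\<And>\<epsilon>. 0 \<le> h \<epsilon>" "\<And>\<epsilon>. f' \<epsilon> \<le> h \<epsilon>"
    "(\<integral>\<^sup>+ \<epsilon>. ennreal (h \<epsilon>) \<partial>std_normal_noise D) \<le> ennreal c'" and c': "0 \<le> c'"
    using assms(2) unfolding mean_le_def by blast
  have "(\<integral>\<^sup>+ \<epsilon>. ennreal (g \<epsilon> + h \<epsilon>) \<partial>std_normal_noise D)
      = (\<integral>\<^sup>+ \<epsilon>. ennreal (g \<epsilon>) \<partial>std_normal_noise D) + (\<integral>\<^sup>+ \<epsilon>. ennreal (h \<epsilon>) \<partial>std_normal_noise D)"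
    using g(1,2) h(1,2) by (simp add: nn_integral_add)
  also have "\<dots> \<le> ennreal (c + c')"
    using add_mono[OF g(4) h(4)] c c' by simp
  finally show ?thesis
    unfolding mean_le_def using g(1-3) h(1-3) c c'
    by (intro conjI bexI[of _ "\<lambda>\<epsilon>. g \<epsilon> + h \<epsilon>"]) (auto intro: add_mono)
qed

lemma mean_le_cmult:
  assumes "mean_le D f c" "0 \<le> k"
  shows "mean_le D (\<lambda>\<epsilon>. k * f \<epsilon>) (k * c)"
proof -
  obtain g where g: "g \<in> borel_measurable (std_normal_noise D)" "\<And>\<epsilon>. 0 \<le> g \<epsilon>" "\<And>\<epsilon>. f \<epsilon> \<le> g \<epsilon>"
    "(\<integral>\<^sup>+ \<epsilon>. ennreal (g \<epsilon>) \<partial>std_normal_noise D) \<le> ennreal c" and c: "0 \<le> c"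
    using assms(1) unfolding mean_le_def by blast
  have "(\<integral>\<^sup>+ \<epsilon>. ennreal (k * g \<epsilon>) \<partial>std_normal_noise D)
      = ennreal k * (\<integral>\<^sup>+ \<epsilon>. ennreal (g \<epsilon>) \<partial>std_normal_noise D)"
    using g(1) assms(2) by (simp add: nn_integral_cmult ennreal_mult')
  also have "\<dots> \<le> ennreal (k * c)"
    using g(4) assms(2) c by (simp add: ennreal_mult mult_left_mono)
  finally show ?thesis
    unfolding mean_le_def using g(1-3) assms(2) c
    by (intro conjI bexI[of _ "\<lambda>\<epsilon>. k * g \<epsilon>"]) (auto intro: mult_left_mono)
qed

lemma mean_le_sum:
  assumes "finite I" "\<And>i. i \<in> I \<Longrightarrow> mean_le D (f i) (c i)"
  shows "mean_le D (\<lambda>\<epsilon>. \<Sum>i\<in>I. f i \<epsilon>) (\<Sum>i\<in>I. c i)"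
  using assms by (induction I) (auto intro: mean_le_add mean_le_const[of 0, simplified])

lemma mean_le_max_0: "mean_le D f c \<Longrightarrow> mean_le D (\<lambda>\<epsilon>. max 0 (f \<epsilon>)) c"
  unfolding mean_le_def by auto

section \<open>Exponential moments of Gaussian quadratic forms\<close>

text \<open>
  Completing the square turns the integrand into a multiple of the density of
  \<open>N(b / (1 - 2 s), 1 / (1 - 2 s))\<close>.
\<close>

lemma nn_integral_std_normal_exp_quadratic:
  fixes b s :: real
  assumes "s < 1/2"
  shows "(\<integral>\<^sup>+ x. ennreal (exp (b * x + s * x\<^sup>2)) \<partial>density lborel (\<lambda>x. ennreal (std_normal_density x)))
    = ennreal (exp (b\<^sup>2 / (2 * (1 - 2 * s))) / sqrt (1 - 2 * s))"
proof -
  define v where "v = 1 - 2 * s"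
  have v: "v > 0" using assms by (simp add: v_def)
  have eq: "std_normal_density x * exp (b * x + s * x\<^sup>2)
      = exp (b\<^sup>2 / (2 * v)) / sqrt v * normal_density (b / v) (1 / sqrt v) x" for x
  proof -
    have "- x\<^sup>2 / 2 + (b * x + s * x\<^sup>2) = b\<^sup>2 / (2 * v) + - (x - b / v)\<^sup>2 / (2 * (1 / sqrt v)\<^sup>2)"
      using v by (simp add: power_divide field_simps power2_eq_square)
        (simp add: v_def algebra_simps)
    then have "exp (- x\<^sup>2 / 2) * exp (b * x + s * x\<^sup>2)
        = exp (b\<^sup>2 / (2 * v)) * exp (- (x - b / v)\<^sup>2 / (2 * (1 / sqrt v)\<^sup>2))"
      by (simp only: exp_add[symmetric])
    moreover have "sqrt (2 * pi * (1 / sqrt v)\<^sup>2) = sqrt (2 * pi) / sqrt v"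
      using v by (simp add: power_divide real_sqrt_divide)
    ultimately show ?thesis
      using v by (simp add: normal_density_def field_simps)
  qed
  have "(\<integral>\<^sup>+ x. ennreal (exp (b * x + s * x\<^sup>2)) \<partial>density lborel (\<lambda>x. ennreal (std_normal_density x)))
      = (\<integral>\<^sup>+ x. ennreal (exp (b\<^sup>2 / (2 * v)) / sqrt v * normal_density (b / v) (1 / sqrt v) x) \<partial>lborel)"
    by (subst nn_integral_density) (auto simp: ennreal_mult'[symmetric] eq)
  also have "\<dots> = ennreal (exp (b\<^sup>2 / (2 * v)) / sqrt v) *
      (\<integral>\<^sup>+ x. ennreal (normal_density (b / v) (1 / sqrt v) x) \<partial>lborel)"
    using v by (subst ennreal_mult', simp) (rule nn_integral_cmult, simp)
  also have "(\<integral>\<^sup>+ x. ennreal (normal_density (b / v) (1 / sqrt v) x) \<partial>lborel) = 1"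
  proof -
    interpret N: prob_space "density lborel (\<lambda>x. ennreal (normal_density (b / v) (1 / sqrt v) x))"
      by (rule prob_space_normal_density) (use v in auto)
    show ?thesis using N.emeasure_space_1 by (simp add: emeasure_density)
  qed
  finally show ?thesis by (simp add: v_def)
qed

text \<open>
  The range of \<open>s\<close> keeps \<open>1 - 2 s\<close> away from \<open>0\<close>, so that \<open>- ln (1 - 2 s) / 2\<close> agrees with \<open>s\<close> up
  to a quadratic error. The linear term has to be exactly \<open>s\<close>: it cancels the mean of the
  chi-square variable, and only the quadratic error is left in the deviation bounds.
\<close>

lemma gaussian_normaliser_le:
  fixes s b :: real
  assumes "\<bar>s\<bar> \<le> 1/4"
  shows "exp (b\<^sup>2 / (2 * (1 - 2 * s))) / sqrt (1 - 2 * s) \<le> exp (b\<^sup>2 + s + 4 * s\<^sup>2)"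
proof -
  define v where "v = 1 - 2 * s"
  have v: "v \<ge> 1/2" using assms by (auto simp: v_def)
  have "\<bar>ln (1 + (- 2 * s)) - (- 2 * s)\<bar> \<le> 2 * (- 2 * s)\<^sup>2"
    by (rule abs_ln_one_plus_x_minus_x_bound) (use assms in auto)
  then have "- ln v / 2 \<le> s + 4 * s\<^sup>2" by (simp add: v_def power2_eq_square)
  moreover have "b\<^sup>2 / (2 * v) \<le> b\<^sup>2 / 1" using v by (intro divide_left_mono) auto
  ultimately have "b\<^sup>2 / (2 * v) - ln v / 2 \<le> b\<^sup>2 + s + 4 * s\<^sup>2" by linarith
  then have "exp (b\<^sup>2 / (2 * v) - ln v / 2) \<le> exp (b\<^sup>2 + s + 4 * s\<^sup>2)" by simp
  moreover have "exp (b\<^sup>2 / (2 * v) - ln v / 2) = exp (b\<^sup>2 / (2 * v)) / sqrt v"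
    using v by (simp only: exp_diff) (simp add: ln_sqrt[symmetric])
  ultimately show ?thesis by (simp only: v_def)
qed

text \<open>
  The Gaussian coordinates are independent, so the mean factorises into one-dimensional integrals.
  Every moment and every deviation bound below is an instance of this estimate.
\<close>

lemma mean_le_exp_quadratic:
  assumes "J \<subseteq> {1..D}" "\<And>i. i \<in> J \<Longrightarrow> \<bar>s i\<bar> \<le> 1/4"
  shows "mean_le D (\<lambda>\<epsilon>. exp (\<Sum>i\<in>J. b i * \<epsilon> i + s i * (\<epsilon> i)\<^sup>2))
    (exp (\<Sum>i\<in>J. (b i)\<^sup>2 + s i + 4 * (s i)\<^sup>2))"
proof -
  let ?N = "density lborel (\<lambda>x. ennreal (std_normal_density x))"
  define f where "f i x = (if i \<in> J then ennreal (exp (b i * x + s i * x\<^sup>2)) else 1)" for i x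
  interpret N: prob_space ?N by (rule prob_space_std_normal)
  interpret P: product_sigma_finite "\<lambda>i::nat. ?N" by standard
  have meas: "(\<lambda>\<epsilon>. \<epsilon> i) \<in> borel_measurable (std_normal_noise D)" if "i \<in> J" for i
    unfolding std_normal_noise_def
    using that assms(1) by (intro measurable_component_singleton[THEN measurable_compose]) auto
  have f_meas: "f i \<in> borel_measurable ?N" for i
    unfolding f_def by measurable
  have J: "finite J" using assms(1) by (rule finite_subset) simp
  have split: "(\<Prod>i\<in>{1..D}. if i \<in> J then h i else (1::ennreal)) = (\<Prod>i\<in>J. h i)" for h
    using assms(1) by (simp add: prod.If_cases Int_absorb1)
  have "(\<integral>\<^sup>+ \<epsilon>. ennreal (exp (\<Sum>i\<in>J. b i * \<epsilon> i + s i * (\<epsilon> i)\<^sup>2)) \<partial>std_normal_noise D)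
      = (\<integral>\<^sup>+ \<epsilon>. (\<Prod>i\<in>{1..D}. f i (\<epsilon> i)) \<partial>(\<Pi>\<^sub>M i\<in>{1..D}. ?N))"
    unfolding std_normal_noise_def f_def split
    by (simp add: exp_sum J prod_ennreal)
  also have "\<dots> = (\<Prod>i\<in>{1..D}. integral\<^sup>N ?N (f i))"
    by (rule P.product_nn_integral_prod) (use f_meas in auto)
  also have "\<dots> = (\<Prod>i\<in>{1..D}. if i \<in> J then integral\<^sup>N ?N (f i) else 1)"
    using N.emeasure_space_1 by (intro prod.cong) (auto simp: f_def[abs_def])
  also have "\<dots> = (\<Prod>i\<in>J. integral\<^sup>N ?N (f i))" by (rule split)
  also have "\<dots> \<le> (\<Prod>i\<in>J. ennreal (exp ((b i)\<^sup>2 + s i + 4 * (s i)\<^sup>2)))"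
  proof (intro prod_mono_ennreal)
    fix i assume i: "i \<in> J"
    then have "integral\<^sup>N ?N (f i) = ennreal (exp ((b i)\<^sup>2 / (2 * (1 - 2 * s i))) / sqrt (1 - 2 * s i))"
      using nn_integral_std_normal_exp_quadratic[of "s i" "b i"] assms(2)[OF i]
      by (simp add: f_def[abs_def] abs_le_iff)
    also have "\<dots> \<le> ennreal (exp ((b i)\<^sup>2 + s i + 4 * (s i)\<^sup>2))"
      by (intro ennreal_leI gaussian_normaliser_le assms(2) i)
    finally show "integral\<^sup>N ?N (f i) \<le> ennreal (exp ((b i)\<^sup>2 + s i + 4 * (s i)\<^sup>2))" .
  qed
  also have "\<dots> = ennreal (exp (\<Sum>i\<in>J. (b i)\<^sup>2 + s i + 4 * (s i)\<^sup>2))"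
    by (simp add: exp_sum J prod_ennreal)
  finally show ?thesis
    unfolding mean_le_def using meas
    by (intro conjI bexI[of _ "\<lambda>\<epsilon>. exp (\<Sum>i\<in>J. b i * \<epsilon> i + s i * (\<epsilon> i)\<^sup>2)"]) auto
qed

section \<open>Moments of the noise\<close>

lemma exp_half_le_2: "exp (1/2::real) \<le> 2"
proof -
  have "(exp (1/2::real))\<^sup>2 = exp 1" by (simp add: exp_double[symmetric])
  also have "\<dots> \<le> 2\<^sup>2" using exp_le by simp
  finally show ?thesis by (rule power2_le_imp_le) simp
qed

lemma mean_le_exp_quarter_square:
  assumes "i \<in> {1..D}"
  shows "mean_le D (\<lambda>\<epsilon>. exp ((\<epsilon> i)\<^sup>2 / 4)) 2"
proof -
  have "mean_le D (\<lambda>\<epsilon>. exp (\<Sum>j\<in>{i}. 0 * \<epsilon> j + 1/4 * (\<epsilon> j)\<^sup>2))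
      (exp (\<Sum>j\<in>{i}. 0\<^sup>2 + 1/4 + 4 * (1/4)\<^sup>2))"
    by (rule mean_le_exp_quadratic) (use assms in auto)
  then show ?thesis
    by (rule mean_le_mono) (use exp_half_le_2 in \<open>auto simp: power2_eq_square\<close>)
qed

lemma mean_le_square:
  assumes "i \<in> {1..D}"
  shows "mean_le D (\<lambda>\<epsilon>. (\<epsilon> i)\<^sup>2) 8"
proof (rule mean_le_mono[OF mean_le_cmult[OF mean_le_exp_quarter_square[OF assms], of 4]])
  fix \<epsilon> :: "nat \<Rightarrow> real"
  show "(\<epsilon> i)\<^sup>2 \<le> 4 * exp ((\<epsilon> i)\<^sup>2 / 4)"
    using exp_ge_add_one_self[of "(\<epsilon> i)\<^sup>2 / 4"] by linarith
qed auto

lemma mean_le_fourth_power: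
  assumes "i \<in> {1..D}"
  shows "mean_le D (\<lambda>\<epsilon>. ((\<epsilon> i)\<^sup>2)\<^sup>2) 64"
proof (rule mean_le_mono[OF mean_le_cmult[OF mean_le_exp_quarter_square[OF assms], of 32]])
  fix \<epsilon> :: "nat \<Rightarrow> real"
  have "y\<^sup>2 \<le> 32 * exp (y / 4)" if "y \<ge> 0" for y :: real
    using exp_lower_Taylor_quadratic[of "y / 4"] that by (simp add: power_divide)
  then show "((\<epsilon> i)\<^sup>2)\<^sup>2 \<le> 32 * exp ((\<epsilon> i)\<^sup>2 / 4)" by (meson zero_le_power2)
qed auto

text \<open>
  The deficit has standard deviation of order \<open>sqrt D\<close>, so it is exponentiated at the scale
  \<open>4 sqrt D\<close>, the smallest multiple for which the exponent stays in the admissible range for all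
  \<open>D \<ge> 1\<close>.
\<close>

lemma mean_le_chi_square_deficit:
  assumes "D \<ge> 1"
  shows "mean_le D (\<lambda>\<epsilon>. real D - (\<Sum>i = 1..D. (\<epsilon> i)\<^sup>2)) (8 * sqrt (real D))"
proof -
  define r where "r = sqrt (real D)"
  have r: "r \<ge> 1" "r\<^sup>2 = real D" using assms by (auto simp: r_def)
  define s where "s = - (1 / (4 * r))"
  have s: "\<bar>s\<bar> \<le> 1/4" using r by (simp add: s_def field_simps)
  have "real D * (4 * s\<^sup>2) = 1/4"
    using r assms by (simp add: s_def power_divide power_mult_distrib)
  then have "exp (- s * real D) * exp (\<Sum>i = 1..D. 0\<^sup>2 + s + 4 * s\<^sup>2) = exp (1/4)"
    by (simp add: exp_add[symmetric] algebra_simps)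
  also have "\<dots> \<le> exp (1/2)" by simp
  also note exp_half_le_2
  finally have "4 * r * (exp (- s * real D) * exp (\<Sum>i = 1..D. 0\<^sup>2 + s + 4 * s\<^sup>2)) \<le> 8 * r"
    using r by simp
  moreover have "real D - (\<Sum>i = 1..D. (\<epsilon> i)\<^sup>2)
      \<le> 4 * r * (exp (- s * real D) * exp (\<Sum>i = 1..D. 0 * \<epsilon> i + s * (\<epsilon> i)\<^sup>2))"
    for \<epsilon> :: "nat \<Rightarrow> real"
  proof -
    define x where "x = real D - (\<Sum>i = 1..D. (\<epsilon> i)\<^sup>2)"
    have "x = 4 * r * (- s * x)" using r by (simp add: s_def)
    also have "\<dots> \<le> 4 * r * exp (- s * x)"
      using exp_ge_add_one_self[of "- s * x"] r by (intro mult_left_mono) auto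
    also have "exp (- s * x) = exp (- s * real D) * exp (\<Sum>i = 1..D. 0 * \<epsilon> i + s * (\<epsilon> i)\<^sup>2)"
      by (simp add: exp_add[symmetric] x_def algebra_simps sum_distrib_left sum_negf)
    finally show ?thesis by (simp add: x_def)
  qed
  ultimately show ?thesis
    using r s unfolding r_def[symmetric]
    by (intro mean_le_mono[OF mean_le_cmult[OF mean_le_cmult[OF
          mean_le_exp_quadratic[of "{1..D}" D "\<lambda>_. s" "\<lambda>_. 0"], of "exp (- s * real D)"],
          of "4 * r"]]) auto
qed

text \<open>
  The quotient is the square of a standard normal variable; if all coefficients vanish, it is
  \<open>0 / 0 = 0\<close> and the bound still holds.
\<close>

lemma mean_le_normalised_linear_form_square:
  assumes "J \<subseteq> {1..D}"
  shows "mean_le D (\<lambda>\<epsilon>. (\<Sum>i\<in>J. a i * \<epsilon> i)\<^sup>2 / (\<Sum>i\<in>J. (a i)\<^sup>2)) 12"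
proof -
  define V where "V = (\<Sum>i\<in>J. (a i)\<^sup>2)"
  have V: "V \<ge> 0" unfolding V_def by (intro sum_nonneg) auto
  have *: "mean_le D (\<lambda>\<epsilon>. exp (c * (\<Sum>i\<in>J. a i * \<epsilon> i) / sqrt V)) 3" if "\<bar>c\<bar> = 1" for c
  proof (rule mean_le_mono[OF mean_le_exp_quadratic[of J D "\<lambda>_. 0" "\<lambda>i. c * a i / sqrt V"]])
    fix \<epsilon>
    show "exp (c * (\<Sum>i\<in>J. a i * \<epsilon> i) / sqrt V)
        \<le> exp (\<Sum>i\<in>J. c * a i / sqrt V * \<epsilon> i + 0 * (\<epsilon> i)\<^sup>2)"
      by (simp add: sum_distrib_left sum_divide_distrib mult.assoc)
  next
    have "c\<^sup>2 = 1" using that by (metis one_power2 power2_abs)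
    then have "(\<Sum>i\<in>J. (c * a i / sqrt V)\<^sup>2 + 0 + 4 * 0\<^sup>2) = V / V"
      using V by (simp add: power_divide power_mult_distrib sum_divide_distrib[symmetric] V_def)
    also have "\<dots> \<le> 1" by simp
    finally show "exp (\<Sum>i\<in>J. (c * a i / sqrt V)\<^sup>2 + 0 + 4 * 0\<^sup>2) \<le> 3"
      using exp_le by (meson exp_le_cancel_iff order_trans)
  qed (use assms in auto)
  have sq: "x\<^sup>2 \<le> 2 * (exp x + exp (- x))" for x :: real
  proof -
    have "\<bar>x\<bar>\<^sup>2 / 2 \<le> exp \<bar>x\<bar>"
      using exp_lower_Taylor_quadratic[of "\<bar>x\<bar>"] by linarith
    also have "\<dots> \<le> exp x + exp (- x)" by (cases "x \<ge> 0") auto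
    finally show ?thesis by simp
  qed
  show ?thesis
    unfolding V_def[symmetric]
  proof (rule mean_le_mono[OF mean_le_cmult[OF mean_le_add[OF *[of 1] *[of "- 1"]], of 2]])
    fix \<epsilon>
    show "(\<Sum>i\<in>J. a i * \<epsilon> i)\<^sup>2 / V \<le> 2 * (exp (1 * (\<Sum>i\<in>J. a i * \<epsilon> i) / sqrt V)
        + exp (- 1 * (\<Sum>i\<in>J. a i * \<epsilon> i) / sqrt V))"
      using sq[of "(\<Sum>i\<in>J. a i * \<epsilon> i) / sqrt V"] V by (simp add: power_divide)
  qed auto
qed

section \<open>Elementary estimates\<close>

lemma exp_minus_le_powr:
  fixes x q :: real
  assumes "x > 0" "q > 0"
  shows "exp (- x) \<le> (q / x) powr q"
proof -
  have "x / q \<le> exp (x / q)" using exp_ge_add_one_self[of "x / q"] by linarith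
  then have "(x / q) powr q \<le> exp (x / q) powr q" using assms by (intro powr_mono2) auto
  also have "\<dots> = exp x" using assms by (simp add: powr_def)
  finally show ?thesis using assms
    by (simp add: powr_divide exp_minus field_simps)
qed

lemma sum_inverse_square_tail_le:
  assumes "N \<ge> 1"
  shows "(\<Sum>i = N+1..M. 1 / (real i)\<^sup>2) \<le> 1 / real N"
proof -
  have "(\<Sum>i = N+1..M. 1 / (real i)\<^sup>2) \<le> 1 / real N - 1 / real M" if "N \<le> M"
    using that
  proof (induction M rule: dec_induct)
    case (step n)
    have n: "real n > 0" using step assms by simp
    have "1 / (real (Suc n))\<^sup>2 \<le> 1 / (real n * real (Suc n))"
      unfolding power2_eq_square using n by (intro divide_left_mono mult_right_mono) auto
    also have "\<dots> = 1 / real n - 1 / real (Suc n)"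
      using n by (simp add: field_simps)
    finally have "1 / (real (Suc n))\<^sup>2 \<le> 1 / real n - 1 / real (Suc n)" .
    then show ?case using step by simp
  qed simp
  moreover have "1 / real N - 1 / real M \<le> 1 / real N" by simp
  ultimately show ?thesis by (cases "N \<le> M") (linarith, simp)
qed

section \<open>Threshold crossing of the residual\<close>

lemma stopping_index_props:
  fixes Y :: "nat \<Rightarrow> real"
  assumes "m\<^sub>0 \<le> D" "\<kappa> > 0"
  defines "\<tau> \<equiv> stopping_index D m\<^sub>0 \<kappa> Y"
  shows "\<tau> \<le> D" "residual_sq D \<tau> Y \<le> \<kappa>"
    "\<And>m. m\<^sub>0 \<le> m \<Longrightarrow> m < \<tau> \<Longrightarrow> \<kappa> < residual_sq D m Y"
proof -
  let ?A = "{m \<in> {m\<^sub>0..D}. residual_sq D m Y \<le> \<kappa>}"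
  have "D \<in> ?A" using assms by (simp add: residual_sq_def)
  then have "\<tau> \<in> ?A" unfolding \<tau>_def stopping_index_def by (intro Min_in) auto
  then show le: "\<tau> \<le> D" and "residual_sq D \<tau> Y \<le> \<kappa>" by auto
  fix m assume "m\<^sub>0 \<le> m" "m < \<tau>"
  moreover have "m \<notin> ?A"
  proof
    assume "m \<in> ?A"
    then have "\<tau> \<le> m" unfolding \<tau>_def stopping_index_def by (intro Min_le) auto
    then show False using \<open>m < \<tau>\<close> by simp
  qed
  ultimately show "\<kappa> < residual_sq D m Y" using le by auto
qed

section \<open>The model for one fixed signal\<close>

text \<open>
  The smoothness \<open>\<beta>\<close> and the radius \<open>R\<close> are tied to the minimax index \<open>t\<close> by
  \<open>R\<^sup>2 = \<delta>\<^sup>2 t\<^bsup>2\<beta> + 2p + 1\<^esup>\<close>, which is the definition of \<open>t\<close> solved for \<open>R\<close>.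
\<close>

locale sobolev_svd_model =
  fixes D :: nat and \<delta> \<kappa> p CA Ck t \<beta> R :: real and lam \<mu> :: "nat \<Rightarrow> real"
  assumes D: "2 \<le> D" and \<delta>: "0 < \<delta>" and p: "0 \<le> p" and CA: "1 \<le> CA" and Ck: "0 \<le> Ck"
    and \<beta>: "0 \<le> \<beta>"
    and lam_ge: "\<And>i. i \<in> {1..D} \<Longrightarrow> inverse CA * real i powr (- p) \<le> lam i"
    and lam_le: "\<And>i. i \<in> {1..D} \<Longrightarrow> lam i \<le> CA * real i powr (- p)"
    and \<kappa>: "0 < \<kappa>" "\<bar>\<kappa> - real D * \<delta>\<^sup>2\<bar> \<le> Ck * sqrt (real D) * \<delta>\<^sup>2"
    and t: "sqrt (real D) \<le> t" "t \<le> real D"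
    and R: "R\<^sup>2 = \<delta>\<^sup>2 * t powr (2 * \<beta> + 2 * p + 1)"
    and \<mu>: "(\<Sum>i = 1..D. real i powr (2 * \<beta>) * (\<mu> i)\<^sup>2) \<le> R\<^sup>2"
begin

definition drift :: "nat \<Rightarrow> real" where
  "drift i = lam i * \<mu> i / \<delta>"

definition tail_energy :: "nat \<Rightarrow> real" where
  "tail_energy m = (\<Sum>i = m+1..D. (drift i)\<^sup>2)"

definition tail_cross :: "nat \<Rightarrow> (nat \<Rightarrow> real) \<Rightarrow> real" where
  "tail_cross m \<epsilon> = (\<Sum>i = m+1..D. drift i * \<epsilon> i)"

definition residual :: "nat \<Rightarrow> (nat \<Rightarrow> real) \<Rightarrow> real" where
  "residual m \<epsilon> = (\<Sum>i = m+1..D. (drift i + \<epsilon> i)\<^sup>2)"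

lemma residual_sq_observation:
  "residual_sq D m (observation D lam \<delta> \<mu> \<epsilon>) = \<delta>\<^sup>2 * residual m \<epsilon>"
  unfolding residual_sq_def residual_def sum_distrib_left
proof (rule sum.cong)
  fix i assume "i \<in> {m+1..D}"
  then have "observation D lam \<delta> \<mu> \<epsilon> i = \<delta> * (drift i + \<epsilon> i)"
    using \<delta> by (simp add: observation_def drift_def algebra_simps)
  then show "(observation D lam \<delta> \<mu> \<epsilon> i)\<^sup>2 = \<delta>\<^sup>2 * (drift i + \<epsilon> i)\<^sup>2"
    by (simp only: power_mult_distrib)
qed simp

lemma residual_eq:
  "residual m \<epsilon> = tail_energy m + 2 * tail_cross m \<epsilon> + (\<Sum>i = m+1..D. (\<epsilon> i)\<^sup>2)"
  unfolding residual_def tail_energy_def tail_cross_def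
  by (simp add: power2_sum sum.distrib sum_distrib_left algebra_simps)

lemma tail_energy_nonneg: "0 \<le> tail_energy m"
  unfolding tail_energy_def by (intro sum_nonneg) auto

lemma sqrt_D_ge_1: "1 \<le> sqrt (real D)"
  using D by simp

lemma t_ge_1: "1 \<le> t"
  using sqrt_D_ge_1 t by linarith

lemma t_pos: "0 < t"
  using t_ge_1 by linarith

lemma D_le_t_square: "real D \<le> t\<^sup>2"
  using power_mono[OF t(1), of 2] by simp

lemma lam_pos: "i \<in> {1..D} \<Longrightarrow> 0 < lam i"
  using lam_ge[of i] CA
  by (intro less_le_trans[OF _ lam_ge]) (auto intro!: mult_pos_pos)

lemma threshold_bounds:
  "real D - Ck * sqrt (real D) \<le> \<kappa> / \<delta>\<^sup>2" "\<kappa> / \<delta>\<^sup>2 \<le> real D + Ck * sqrt (real D)"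
proof -
  have "\<delta>\<^sup>2 > 0" using \<delta> by simp
  moreover have "(real D - Ck * sqrt (real D)) * \<delta>\<^sup>2 \<le> \<kappa>" "\<kappa> \<le> (real D + Ck * sqrt (real D)) * \<delta>\<^sup>2"
    using \<kappa>(2) by (auto simp: abs_le_iff algebra_simps)
  ultimately show "real D - Ck * sqrt (real D) \<le> \<kappa> / \<delta>\<^sup>2" "\<kappa> / \<delta>\<^sup>2 \<le> real D + Ck * sqrt (real D)"
    by (simp_all add: pos_le_divide_eq pos_divide_le_eq)
qed

lemma inverse_lam_square_le:
  assumes "i \<in> {1..D}"
  shows "(inverse (lam i))\<^sup>2 \<le> CA\<^sup>2 * real i powr (2 * p)"
proof -
  have i: "real i > 0" using assms by auto
  have "inverse (lam i) \<le> inverse (inverse CA * real i powr (- p))"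
    using lam_ge[OF assms] CA i by (intro le_imp_inverse_le) auto
  also have "\<dots> = CA * real i powr p" by (simp add: powr_minus)
  finally have "(inverse (lam i))\<^sup>2 \<le> (CA * real i powr p)\<^sup>2"
    using lam_pos[OF assms] by (intro power_mono) auto
  also have "\<dots> = CA\<^sup>2 * real i powr (2 * p)"
    using i by (simp add: power_mult_distrib powr_power mult.commute)
  finally show ?thesis .
qed

lemma lam_square_le:
  assumes "i \<in> {1..D}"
  shows "(lam i)\<^sup>2 \<le> CA\<^sup>2 * real i powr (- 2 * p)"
proof -
  have i: "real i > 0" using assms by auto
  have "(lam i)\<^sup>2 \<le> (CA * real i powr (- p))\<^sup>2"
    using lam_le[OF assms] lam_pos[OF assms] by (intro power_mono) auto
  also have "\<dots> = CA\<^sup>2 * real i powr (- 2 * p)"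
    using i by (simp add: power_mult_distrib powr_power mult.commute)
  finally show ?thesis .
qed

lemma signal_square_le:
  assumes "i \<in> {1..D}"
  shows "(\<mu> i)\<^sup>2 \<le> CA\<^sup>2 * real i powr (2 * p) * \<delta>\<^sup>2 * (drift i)\<^sup>2"
proof -
  have "(\<mu> i)\<^sup>2 = (inverse (lam i))\<^sup>2 * (\<delta>\<^sup>2 * (drift i)\<^sup>2)"
    using lam_pos[OF assms] \<delta> by (simp add: drift_def power_mult_distrib power_divide field_simps)
  also have "\<dots> \<le> CA\<^sup>2 * real i powr (2 * p) * (\<delta>\<^sup>2 * (drift i)\<^sup>2)"
    using inverse_lam_square_le[OF assms] by (intro mult_right_mono) auto
  finally show ?thesis by (simp add: mult.assoc)
qed

text \<open>
  Beyond \<open>t\<close> the Sobolev weight is at least \<open>t\<^bsup>2\<beta>\<^esup>\<close>, and this factor cancels the \<open>\<beta>\<close> in \<open>R\<^sup>2\<close>.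
  Hence no later constant depends on \<open>\<beta>\<close>.
\<close>

lemma weighted_tail_le:
  assumes "t \<le> real m" "0 \<le> q"
  shows "(\<Sum>i = m+1..D. real i powr (- q) * (\<mu> i)\<^sup>2) \<le> \<delta>\<^sup>2 * t powr (2 * p + 1 - q)"
proof -
  have "(\<Sum>i = m+1..D. real i powr (- q) * (\<mu> i)\<^sup>2)
      \<le> (\<Sum>i = m+1..D. t powr (- (2 * \<beta> + q)) * (real i powr (2 * \<beta>) * (\<mu> i)\<^sup>2))"
  proof (rule sum_mono)
    fix i assume "i \<in> {m+1..D}"
    then have i: "t \<le> real i" using assms by auto
    have "real i powr (- q) = real i powr (- (2 * \<beta> + q)) * real i powr (2 * \<beta>)"
      by (simp add: powr_add[symmetric])
    also have "\<dots> \<le> t powr (- (2 * \<beta> + q)) * real i powr (2 * \<beta>)"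
      using i t_pos \<beta> assms by (intro mult_right_mono powr_mono2') auto
    finally show "real i powr (- q) * (\<mu> i)\<^sup>2
        \<le> t powr (- (2 * \<beta> + q)) * (real i powr (2 * \<beta>) * (\<mu> i)\<^sup>2)"
      by (metis mult.assoc mult_right_mono zero_le_power2)
  qed
  also have "\<dots> \<le> t powr (- (2 * \<beta> + q)) * (\<Sum>i = 1..D. real i powr (2 * \<beta>) * (\<mu> i)\<^sup>2)"
    unfolding sum_distrib_left[symmetric]
    by (intro mult_left_mono sum_mono2) auto
  also have "\<dots> \<le> t powr (- (2 * \<beta> + q)) * R\<^sup>2"
    using \<mu> by (intro mult_left_mono) auto
  also have "\<dots> = \<delta>\<^sup>2 * t powr (2 * p + 1 - q)"
    unfolding R by (simp add: powr_add[symmetric] algebra_simps)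
  finally show ?thesis .
qed

lemma signal_tail_le:
  assumes "t \<le> real m"
  shows "(\<Sum>i = m+1..D. (\<mu> i)\<^sup>2) \<le> \<delta>\<^sup>2 * t powr (2 * p + 1)"
  using weighted_tail_le[OF assms, of 0] by simp

lemma tail_energy_le:
  assumes "t \<le> real m"
  shows "tail_energy m \<le> CA\<^sup>2 * t"
proof -
  have "tail_energy m \<le> (\<Sum>i = m+1..D. CA\<^sup>2 / \<delta>\<^sup>2 * (real i powr (- (2 * p)) * (\<mu> i)\<^sup>2))"
    unfolding tail_energy_def
  proof (rule sum_mono)
    fix i assume "i \<in> {m+1..D}"
    then have "(lam i)\<^sup>2 * ((\<mu> i)\<^sup>2 / \<delta>\<^sup>2) \<le> CA\<^sup>2 * real i powr (- 2 * p) * ((\<mu> i)\<^sup>2 / \<delta>\<^sup>2)"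
      by (intro mult_right_mono lam_square_le) auto
    then show "(drift i)\<^sup>2 \<le> CA\<^sup>2 / \<delta>\<^sup>2 * (real i powr (- (2 * p)) * (\<mu> i)\<^sup>2)"
      by (simp add: drift_def power_divide power_mult_distrib mult_ac)
  qed
  also have "\<dots> \<le> CA\<^sup>2 / \<delta>\<^sup>2 * (\<delta>\<^sup>2 * t powr (2 * p + 1 - 2 * p))"
    unfolding sum_distrib_left[symmetric] using p assms
    by (intro mult_left_mono weighted_tail_le) auto
  also have "\<dots> = CA\<^sup>2 * t" using \<delta> t_pos by simp
  finally show ?thesis .
qed

section \<open>Stopping too early: the bias\<close>

text \<open>
  A residual below the threshold leaves room for little signal energy, because the noise alone
  nearly fills the threshold \<open>\<kappa> \<approx> D \<delta>\<^sup>2\<close>. The cross term can be large where the energy is large, so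
  it is normalised: half of the energy absorbs it up to \<open>2 Z\<^sup>2 / S\<close>.
\<close>

lemma small_residual_imp_small_energy:
  assumes "m \<le> D" "residual m \<epsilon> \<le> \<kappa> / \<delta>\<^sup>2"
  shows "tail_energy m \<le> 2 * (Ck * sqrt (real D) + (real D - (\<Sum>i = 1..D. (\<epsilon> i)\<^sup>2))
    + (\<Sum>i = 1..m. (\<epsilon> i)\<^sup>2) + 2 * ((tail_cross m \<epsilon>)\<^sup>2 / tail_energy m))"
proof -
  let ?S = "tail_energy m" and ?Z = "tail_cross m \<epsilon>"
  have "(\<Sum>i = 1..D. (\<epsilon> i)\<^sup>2) = (\<Sum>i = 1..m. (\<epsilon> i)\<^sup>2) + (\<Sum>i = m+1..D. (\<epsilon> i)\<^sup>2)"
    using assms(1) sum.ub_add_nat[of 1 m "\<lambda>i. (\<epsilon> i)\<^sup>2" "D - m"] by simp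
  moreover have "?S + 2 * ?Z + (\<Sum>i = m+1..D. (\<epsilon> i)\<^sup>2) \<le> real D + Ck * sqrt (real D)"
    using assms(2) threshold_bounds(2) unfolding residual_eq by linarith
  moreover have "- (2 * ?Z) \<le> ?S / 2 + 2 * (?Z\<^sup>2 / ?S)"
  proof (cases "?S = 0")
    case True
    then have "\<And>i. i \<in> {m+1..D} \<Longrightarrow> drift i = 0"
      unfolding tail_energy_def by (subst (asm) sum_nonneg_eq_0_iff) auto
    then have "?Z = 0" by (simp add: tail_cross_def)
    then show ?thesis using True by simp
  next
    case False
    then have S: "?S > 0" using tail_energy_nonneg[of m] by linarith
    have "0 \<le> (?S + 2 * ?Z)\<^sup>2 / (2 * ?S)" using S by simp
    also have "\<dots> = ?S / 2 + 2 * ?Z + 2 * (?Z\<^sup>2 / ?S)"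
      using S by (simp add: power2_eq_square field_simps)
    finally show ?thesis by linarith
  qed
  ultimately show ?thesis by (simp add: algebra_simps)
qed

definition effective_dim :: nat where
  "effective_dim = nat \<lceil>t\<rceil>"

lemma effective_dim: "t \<le> real effective_dim" "real effective_dim \<le> 2 * t" "effective_dim \<le> D"
  using t t_ge_1 unfolding effective_dim_def by (linarith, linarith, simp add: ceiling_le_iff nat_le_iff)

text \<open>
  A majorant of the remaining energy that is uniform over all stopping indices below the effective
  dimension. The maximum over \<open>m\<close> of the normalised cross terms is replaced by their sum: at
  most \<open>2 t\<close> terms of bounded mean have the permitted order \<open>t\<close>.
\<close>

definition undershoot_energy :: "(nat \<Rightarrow> real) \<Rightarrow> real" where
  "undershoot_energy \<epsilon> = 2 * (Ck * sqrt (real D) + max 0 (real D - (\<Sum>i = 1..D. (\<epsilon> i)\<^sup>2))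
    + (\<Sum>i = 1..effective_dim. (\<epsilon> i)\<^sup>2)
    + 2 * (\<Sum>m<effective_dim. (tail_cross m \<epsilon>)\<^sup>2 / tail_energy m))"

lemma undershoot_energy_nonneg: "0 \<le> undershoot_energy \<epsilon>"
  unfolding undershoot_energy_def using Ck tail_energy_nonneg
  by (intro mult_nonneg_nonneg add_nonneg_nonneg sum_nonneg) auto

lemma mean_le_undershoot_energy: "mean_le D undershoot_energy ((144 + 2 * Ck) * t)"
proof -
  have "mean_le D undershoot_energy (2 * (Ck * sqrt (real D) + 8 * sqrt (real D)
      + (\<Sum>i = 1..effective_dim. 8) + 2 * (\<Sum>m<effective_dim. 12)))"
    unfolding undershoot_energy_def tail_cross_def tail_energy_def
    using D Ck effective_dim(3)
    by (intro mean_le_cmult mean_le_add mean_le_const mean_le_sum mean_le_max_0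
        mean_le_chi_square_deficit mean_le_square mean_le_normalised_linear_form_square) auto
  moreover have "2 * (Ck * sqrt (real D) + 8 * sqrt (real D)
      + (\<Sum>i = 1..effective_dim. 8) + 2 * (\<Sum>m<effective_dim. 12)) \<le> (144 + 2 * Ck) * t"
    using t(1) effective_dim(2) mult_left_mono[OF t(1) Ck] by (simp add: algebra_simps)
  ultimately show ?thesis by (rule mean_le_mono[OF _ order_refl])
qed

text \<open>
  The signal beyond the effective dimension is controlled by the ellipsoid; below it, inverting the
  singular values costs at most the factor \<open>CA\<^sup>2 T\<^bsup>2p\<^esup>\<close>, where \<open>T\<close> is the effective dimension.
\<close>

lemma bias_le:
  assumes "m \<le> D" "residual m \<epsilon> \<le> \<kappa> / \<delta>\<^sup>2"
  shows "(\<Sum>i = m+1..D. (\<mu> i)\<^sup>2) \<le> \<delta>\<^sup>2 * t powr (2 * p + 1)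
    + CA\<^sup>2 * real effective_dim powr (2 * p) * \<delta>\<^sup>2 * undershoot_energy \<epsilon>"
proof (cases "effective_dim \<le> m")
  case True
  then have "t \<le> real m" using effective_dim(1) by linarith
  moreover have "0 \<le> CA\<^sup>2 * real effective_dim powr (2 * p) * \<delta>\<^sup>2 * undershoot_energy \<epsilon>"
    using undershoot_energy_nonneg by simp
  ultimately show ?thesis using signal_tail_le[of m] by linarith
next
  case False
  let ?T = effective_dim
  have "(\<Sum>i = m+1..?T. (\<mu> i)\<^sup>2) \<le> (\<Sum>i = m+1..?T. CA\<^sup>2 * real ?T powr (2 * p) * \<delta>\<^sup>2 * (drift i)\<^sup>2)"
  proof (rule sum_mono)
    fix i assume i: "i \<in> {m+1..?T}"
    then have "(\<mu> i)\<^sup>2 \<le> CA\<^sup>2 * real i powr (2 * p) * \<delta>\<^sup>2 * (drift i)\<^sup>2"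
      using effective_dim(3) by (intro signal_square_le) auto
    also have "\<dots> \<le> CA\<^sup>2 * real ?T powr (2 * p) * \<delta>\<^sup>2 * (drift i)\<^sup>2"
      using i p by (intro mult_right_mono mult_left_mono powr_mono2) auto
    finally show "(\<mu> i)\<^sup>2 \<le> CA\<^sup>2 * real ?T powr (2 * p) * \<delta>\<^sup>2 * (drift i)\<^sup>2" .
  qed
  also have "\<dots> \<le> CA\<^sup>2 * real ?T powr (2 * p) * \<delta>\<^sup>2 * tail_energy m"
    unfolding tail_energy_def sum_distrib_left[symmetric] using effective_dim(3)
    by (intro mult_left_mono sum_mono2) auto
  also have "\<dots> \<le> CA\<^sup>2 * real ?T powr (2 * p) * \<delta>\<^sup>2 * undershoot_energy \<epsilon>"
  proof (rule mult_left_mono)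
    have "(\<Sum>i = 1..m. (\<epsilon> i)\<^sup>2) \<le> (\<Sum>i = 1..?T. (\<epsilon> i)\<^sup>2)"
      using False by (intro sum_mono2) auto
    moreover have "(tail_cross m \<epsilon>)\<^sup>2 / tail_energy m \<le> (\<Sum>m<?T. (tail_cross m \<epsilon>)\<^sup>2 / tail_energy m)"
      using False tail_energy_nonneg
      by (intro member_le_sum[of m _ "\<lambda>m. (tail_cross m \<epsilon>)\<^sup>2 / tail_energy m"]) auto
    ultimately have "2 * (Ck * sqrt (real D) + (real D - (\<Sum>i = 1..D. (\<epsilon> i)\<^sup>2))
        + (\<Sum>i = 1..m. (\<epsilon> i)\<^sup>2) + 2 * ((tail_cross m \<epsilon>)\<^sup>2 / tail_energy m))
      \<le> undershoot_energy \<epsilon>"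
      unfolding undershoot_energy_def by (intro mult_left_mono add_mono order_refl) auto
    then show "tail_energy m \<le> undershoot_energy \<epsilon>"
      using small_residual_imp_small_energy[OF assms] by (rule order_trans[rotated])
  qed auto
  finally have "(\<Sum>i = m+1..?T. (\<mu> i)\<^sup>2) \<le> CA\<^sup>2 * real ?T powr (2 * p) * \<delta>\<^sup>2 * undershoot_energy \<epsilon>" .
  moreover have "(\<Sum>i = m+1..D. (\<mu> i)\<^sup>2) = (\<Sum>i = m+1..?T. (\<mu> i)\<^sup>2) + (\<Sum>i = ?T+1..D. (\<mu> i)\<^sup>2)"
    using False effective_dim(3) sum.ub_add_nat[of "m+1" ?T "\<lambda>i. (\<mu> i)\<^sup>2" "D - ?T"] by simp
  moreover have "(\<Sum>i = ?T+1..D. (\<mu> i)\<^sup>2) \<le> \<delta>\<^sup>2 * t powr (2 * p + 1)"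
    by (intro signal_tail_le effective_dim)
  ultimately show ?thesis by linarith
qed

section \<open>Stopping too late: the noise\<close>

definition overshoot_const :: real where
  "overshoot_const = 2 * CA\<^sup>2 + Ck"

lemma overshoot_const_ge_2: "2 \<le> overshoot_const"
  using Ck one_le_power[OF CA, of 2] unfolding overshoot_const_def by linarith

text \<open>
  Chernoff's bound. The mean of the residual lies below the threshold by at least \<open>m / 2\<close>, since
  \<open>overshoot_const * t\<close> accounts for the signal energy beyond \<open>m\<close>, which enters the exponential
  moment at most twice, and for the tolerance in \<open>\<kappa>\<close>.
\<close>

lemma residual_exceeds_threshold_mean_le:
  assumes "2 * overshoot_const * t \<le> real m" "m \<le> D"
  shows "mean_le D (\<lambda>\<epsilon>. if \<kappa> / \<delta>\<^sup>2 < residual m \<epsilon> then 1 else 0)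
    (exp (- ((real m)\<^sup>2 / (64 * real D))))"
proof -
  define J where "J = {m+1..D}"
  \<comment> \<open>This \<open>s\<close> minimises the exponent \<open>- s m / 2 + 4 s\<^sup>2 D\<close>.\<close>
  define s where "s = real m / (16 * real D)"
  have s: "0 \<le> s" "s \<le> 1/16" using assms(2) D by (auto simp: s_def field_simps)
  have "1 * t \<le> 2 * overshoot_const * t"
    using overshoot_const_ge_2 t_pos by (intro mult_right_mono) auto
  then have tm: "t \<le> real m" using assms(1) by linarith
  define K where "K = exp (s * tail_energy m - s * (\<kappa> / \<delta>\<^sup>2))"
  have "mean_le D (\<lambda>\<epsilon>. K * exp (\<Sum>i\<in>J. 2 * s * drift i * \<epsilon> i + s * (\<epsilon> i)\<^sup>2))
      (K * exp (\<Sum>i\<in>J. (2 * s * drift i)\<^sup>2 + s + 4 * s\<^sup>2))"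
    using s by (intro mean_le_cmult mean_le_exp_quadratic) (auto simp: K_def J_def)
  then show ?thesis
  proof (rule mean_le_mono)
    fix \<epsilon>
    have "K * exp (\<Sum>i\<in>J. 2 * s * drift i * \<epsilon> i + s * (\<epsilon> i)\<^sup>2)
        = exp (s * (residual m \<epsilon> - \<kappa> / \<delta>\<^sup>2))"
      unfolding K_def exp_add[symmetric] residual_eq tail_cross_def J_def
      by (simp add: sum.distrib sum_distrib_left algebra_simps)
    moreover have "(if \<kappa> / \<delta>\<^sup>2 < residual m \<epsilon> then 1 else 0) \<le> exp (s * (residual m \<epsilon> - \<kappa> / \<delta>\<^sup>2))"
      using s by auto
    ultimately show "(if \<kappa> / \<delta>\<^sup>2 < residual m \<epsilon> then 1 else 0)
        \<le> K * exp (\<Sum>i\<in>J. 2 * s * drift i * \<epsilon> i + s * (\<epsilon> i)\<^sup>2)" by simp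
  next
    have sum_eq: "(\<Sum>i\<in>J. (2 * s * drift i)\<^sup>2 + s + 4 * s\<^sup>2)
        = 4 * s\<^sup>2 * tail_energy m + (real D - real m) * s + (real D - real m) * (4 * s\<^sup>2)"
      using assms(2) unfolding tail_energy_def J_def
      by (simp add: sum.distrib sum_distrib_left power_mult_distrib of_nat_diff algebra_simps)
    have "s * tail_energy m + 4 * s\<^sup>2 * tail_energy m = (s + s * (4 * s)) * tail_energy m"
      by (simp add: power2_eq_square algebra_simps)
    also have "\<dots> \<le> (s + s * 1) * (CA\<^sup>2 * t)"
      using s tail_energy_le[OF tm] tail_energy_nonneg
      by (intro mult_mono add_left_mono mult_left_mono) auto
    finally have 1: "s * tail_energy m + 4 * s\<^sup>2 * tail_energy m \<le> s * (2 * CA\<^sup>2 * t)"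
      by (simp add: algebra_simps)
    have "real D - Ck * t \<le> \<kappa> / \<delta>\<^sup>2"
      using threshold_bounds(1) mult_left_mono[OF t(1) Ck] by linarith
    then have 2: "s * (real D - Ck * t) \<le> s * (\<kappa> / \<delta>\<^sup>2)" using s by (intro mult_left_mono) auto
    have 3: "(real D - real m) * (4 * s\<^sup>2) \<le> real D * (4 * s\<^sup>2)"
      by (intro mult_right_mono) auto
    have 4: "s * (overshoot_const * t - real m) \<le> s * (- real m / 2)"
      using s assms(1) by (intro mult_left_mono) auto
    have 5: "s * (- real m / 2) + real D * (4 * s\<^sup>2) = - ((real m)\<^sup>2 / (64 * real D))"
      using D by (simp add: s_def field_simps power2_eq_square)
    have 6: "s * (2 * CA\<^sup>2 * t) - s * (real D - Ck * t) + (real D - real m) * s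
        = s * (overshoot_const * t - real m)"
      by (simp add: overshoot_const_def algebra_simps)
    have "s * tail_energy m - s * (\<kappa> / \<delta>\<^sup>2) + (\<Sum>i\<in>J. (2 * s * drift i)\<^sup>2 + s + 4 * s\<^sup>2)
        \<le> - ((real m)\<^sup>2 / (64 * real D))"
      using 1 2 3 4 5 6 unfolding sum_eq by linarith
    then show "K * exp (\<Sum>i\<in>J. (2 * s * drift i)\<^sup>2 + s + 4 * s\<^sup>2) \<le> exp (- ((real m)\<^sup>2 / (64 * real D)))"
      unfolding K_def by (simp only: exp_add[symmetric] exp_le_cancel_iff)
  qed
qed

text \<open>
  The event depends on \<open>\<epsilon> (m + 1)\<close> too. The two factors are decoupled by \<open>x \<le> w x\<^sup>2 / 2 + 1 / (2 w)\<close>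
  with \<open>w\<close> the square root of the probability bound, which only halves the exponent.
\<close>

lemma late_noise_mean_le:
  assumes "2 * overshoot_const * t \<le> real m" "m + 1 \<le> D"
  shows "mean_le D (\<lambda>\<epsilon>. if \<kappa> / \<delta>\<^sup>2 < residual m \<epsilon> then (\<epsilon> (m+1))\<^sup>2 else 0)
    (33 * exp (- ((real m)\<^sup>2 / (128 * real D))))"
proof -
  define w where "w = exp (- ((real m)\<^sup>2 / (128 * real D)))"
  have w: "w > 0" "exp (- ((real m)\<^sup>2 / (64 * real D))) = w * w"
    by (auto simp: w_def exp_add[symmetric])
  define I where "I \<epsilon> = (if \<kappa> / \<delta>\<^sup>2 < residual m \<epsilon> then 1 else 0::real)" for \<epsilon>
  have "mean_le D I (w * w)"
    unfolding I_def[abs_def] w(2)[symmetric]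
    by (rule residual_exceeds_threshold_mean_le) (use assms in auto)
  then have "mean_le D (\<lambda>\<epsilon>. w / 2 * ((\<epsilon> (m+1))\<^sup>2)\<^sup>2 + 1 / (2 * w) * I \<epsilon>) (w / 2 * 64 + 1 / (2 * w) * (w * w))"
    using w assms by (intro mean_le_add mean_le_cmult mean_le_fourth_power) auto
  then show ?thesis
  proof (rule mean_le_mono)
    fix \<epsilon> :: "nat \<Rightarrow> real"
    have "x \<le> w / 2 * x\<^sup>2 + 1 / (2 * w)" for x
    proof -
      have "0 \<le> (w * x - 1)\<^sup>2 / (2 * w)" using w by simp
      also have "\<dots> = w / 2 * x\<^sup>2 + 1 / (2 * w) - x"
        using w by (simp add: power2_eq_square field_simps)
      finally show ?thesis by simp
    qed
    from this[of "(\<epsilon> (m+1))\<^sup>2"] w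
    show "(if \<kappa> / \<delta>\<^sup>2 < residual m \<epsilon> then (\<epsilon> (m+1))\<^sup>2 else 0)
      \<le> w / 2 * ((\<epsilon> (m+1))\<^sup>2)\<^sup>2 + 1 / (2 * w) * I \<epsilon>"
      unfolding I_def by auto
  qed (use w in \<open>simp add: w_def[symmetric]\<close>)
qed

definition cutoff :: nat where
  "cutoff = nat \<lceil>2 * overshoot_const * t\<rceil>"

lemma cutoff: "2 * overshoot_const * t \<le> real cutoff" "real cutoff \<le> 3 * overshoot_const * t"
  "2 * t \<le> real cutoff"
proof -
  have "1 * 1 \<le> overshoot_const * t"
    using overshoot_const_ge_2 t_ge_1 by (intro mult_mono) auto
  moreover have "2 * t \<le> overshoot_const * t"
    using overshoot_const_ge_2 t_pos by (intro mult_right_mono) auto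
  ultimately show "2 * overshoot_const * t \<le> real cutoff"
    "real cutoff \<le> 3 * overshoot_const * t" "2 * t \<le> real cutoff"
    using t_pos unfolding cutoff_def by linarith+
qed

definition late_const :: real where
  "late_const = 33 * (512 * (p + 1)) powr (p + 1)"

text \<open>
  Trading the exponential for the power \<open>p + 1\<close> of \<open>D / i\<^sup>2\<close> leaves the summable weight \<open>1 / i\<^sup>2\<close>, and
  \<open>D \<le> t\<^sup>2\<close> turns \<open>D\<close> into the scale \<open>t\<close>.
\<close>

lemma weighted_exp_le:
  assumes "cutoff < i"
  shows "real i powr (2 * p) * (33 * exp (- ((real (i - 1))\<^sup>2 / (128 * real D))))
    \<le> late_const * t powr (2 * p + 2) * (1 / (real i)\<^sup>2)"
proof -
  have i: "2 \<le> i" using assms cutoff(3) t_ge_1 by linarith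
  define q where "q = p + 1"
  have q: "q > 0" using p by (simp add: q_def)
  define x where "x = (real i)\<^sup>2 / (512 * real D)"
  have x: "x > 0" using i D by (simp add: x_def)
  have "real i / 2 \<le> real (i - 1)" using i by simp
  then have "(real i / 2)\<^sup>2 \<le> (real (i - 1))\<^sup>2" by (intro power_mono) auto
  then have "x \<le> (real (i - 1))\<^sup>2 / (128 * real D)"
    using D by (simp add: x_def power_divide field_simps)
  then have "exp (- ((real (i - 1))\<^sup>2 / (128 * real D))) \<le> exp (- x)" by simp
  also have "\<dots> \<le> (q / x) powr q" using x q by (rule exp_minus_le_powr)
  also have "q / x = (512 * q) * (real D / (real i)\<^sup>2)" by (simp add: x_def)
  also have "\<dots> powr q \<le> ((512 * q) * (t\<^sup>2 / (real i)\<^sup>2)) powr q"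
    using q D_le_t_square by (intro powr_mono2 mult_left_mono divide_right_mono) auto
  also have "\<dots> = (512 * q) powr q * (t powr (2 * q) / real i powr (2 * q))"
  proof -
    have sq: "(y\<^sup>2) powr q = y powr (2 * q)" if "y > 0" for y :: real
      using that powr_powr[of y 2 q] by simp
    have "(t\<^sup>2 / (real i)\<^sup>2) powr q = t powr (2 * q) / real i powr (2 * q)"
      using t_pos i by (subst powr_divide) (simp_all add: sq)
    then show ?thesis using q by (subst powr_mult) auto
  qed
  finally have "real i powr (2 * p) * (33 * exp (- ((real (i - 1))\<^sup>2 / (128 * real D))))
     \<le> real i powr (2 * p) * (33 * ((512 * q) powr q * (t powr (2 * q) / real i powr (2 * q))))"
    by (intro mult_left_mono) auto
  also have "\<dots> = late_const * t powr (2 * p + 2) * (real i powr (2 * p) / real i powr (2 * q))"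
    by (simp add: late_const_def q_def algebra_simps)
  also have "real i powr (2 * p) / real i powr (2 * q) = 1 / (real i)\<^sup>2"
  proof -
    have "real i powr (2 * q) = real i powr (2 * p) * (real i)\<^sup>2"
      using i by (simp add: q_def distrib_left powr_add)
    then show ?thesis using i by simp
  qed
  finally show ?thesis .
qed

definition noise_up_to :: "nat \<Rightarrow> (nat \<Rightarrow> real) \<Rightarrow> real" where
  "noise_up_to m \<epsilon> = (\<Sum>i = 1..D. real i powr (2 * p) * (if i \<le> m then (\<epsilon> i)\<^sup>2 else 0))"

text \<open>
  For late \<open>i\<close>, the event \<open>i \<le> \<tau>\<close> forces the residual at \<open>i - 1\<close> above the threshold. This is the only
  way in which \<open>\<tau>\<close> enters, and it holds from the starting index on, hence the bound on \<open>m\<^sub>0\<close>.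
\<close>

lemma mean_le_stopped_noise:
  assumes m\<^sub>0: "m\<^sub>0 \<le> cutoff"
    and \<tau>: "\<And>\<epsilon> m. m\<^sub>0 \<le> m \<Longrightarrow> m < \<tau> \<epsilon> \<Longrightarrow> \<kappa> / \<delta>\<^sup>2 < residual m \<epsilon>"
  shows "mean_le D (\<lambda>\<epsilon>. noise_up_to (\<tau> \<epsilon>) \<epsilon>)
    ((8 * (3 * overshoot_const) powr (2 * p + 1) + late_const) * t powr (2 * p + 1))"
proof -
  define c where "c i = (if i \<le> cutoff then real i powr (2 * p) * 8
    else late_const * t powr (2 * p + 2) * (1 / (real i)\<^sup>2))" for i
  have late: "late_const \<ge> 0" by (simp add: late_const_def)
  have c_nonneg: "c i \<ge> 0" for i using late by (simp add: c_def)
  have "mean_le D (\<lambda>\<epsilon>. real i powr (2 * p) * (if i \<le> \<tau> \<epsilon> then (\<epsilon> i)\<^sup>2 else 0)) (c i)"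
    if i: "i \<in> {1..D}" for i
  proof (cases "i \<le> cutoff")
    case True
    have "mean_le D (\<lambda>\<epsilon>. real i powr (2 * p) * (\<epsilon> i)\<^sup>2) (real i powr (2 * p) * 8)"
      using i by (intro mean_le_cmult mean_le_square) auto
    then show ?thesis
      by (rule mean_le_mono) (auto simp: c_def True)
  next
    case False
    define m where "m = i - 1"
    have m: "i = m + 1" "cutoff \<le> m" using i False by (auto simp: m_def)
    have "mean_le D (\<lambda>\<epsilon>. real i powr (2 * p) * (if \<kappa> / \<delta>\<^sup>2 < residual m \<epsilon> then (\<epsilon> (m+1))\<^sup>2 else 0))
        (real i powr (2 * p) * (33 * exp (- ((real m)\<^sup>2 / (128 * real D)))))"
      using i m cutoff(1) by (intro mean_le_cmult late_noise_mean_le) auto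
    then show ?thesis
    proof (rule mean_le_mono)
      fix \<epsilon>
      show "real i powr (2 * p) * (if i \<le> \<tau> \<epsilon> then (\<epsilon> i)\<^sup>2 else 0)
          \<le> real i powr (2 * p) * (if \<kappa> / \<delta>\<^sup>2 < residual m \<epsilon> then (\<epsilon> (m+1))\<^sup>2 else 0)"
        using \<tau>[of m \<epsilon>] m m\<^sub>0 by (intro mult_left_mono) auto
    next
      show "real i powr (2 * p) * (33 * exp (- ((real m)\<^sup>2 / (128 * real D)))) \<le> c i"
        using weighted_exp_le[of i] False by (simp add: c_def m_def)
    qed
  qed
  then have "mean_le D (\<lambda>\<epsilon>. noise_up_to (\<tau> \<epsilon>) \<epsilon>) (\<Sum>i = 1..D. c i)"
    unfolding noise_up_to_def by (intro mean_le_sum) auto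
  moreover have "(\<Sum>i = 1..D. c i)
      \<le> (8 * (3 * overshoot_const) powr (2 * p + 1) + late_const) * t powr (2 * p + 1)"
  proof -
    have "(\<Sum>i = 1..D. c i) \<le> (\<Sum>i\<in>{1..cutoff} \<union> {cutoff+1..D}. c i)"
      using c_nonneg by (intro sum_mono2) auto
    also have "\<dots> = (\<Sum>i = 1..cutoff. c i) + (\<Sum>i = cutoff+1..D. c i)"
      by (intro sum.union_disjoint) auto
    also have "(\<Sum>i = 1..cutoff. c i) \<le> (\<Sum>i = 1..cutoff. real cutoff powr (2 * p) * 8)"
      using p by (intro sum_mono) (auto simp: c_def intro!: powr_mono2)
    also have "\<dots> = 8 * real cutoff powr (2 * p + 1)"
      by (simp add: powr_add)
    also have "\<dots> \<le> 8 * (3 * overshoot_const * t) powr (2 * p + 1)"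
      using p cutoff(2) by (intro mult_left_mono powr_mono2) auto
    also have "\<dots> = 8 * (3 * overshoot_const) powr (2 * p + 1) * t powr (2 * p + 1)"
      using overshoot_const_ge_2 t_pos by (subst powr_mult) auto
    also have "(\<Sum>i = cutoff+1..D. c i)
        = late_const * t powr (2 * p + 2) * (\<Sum>i = cutoff+1..D. 1 / (real i)\<^sup>2)"
      unfolding sum_distrib_left by (intro sum.cong) (auto simp: c_def)
    also have "\<dots> \<le> late_const * t powr (2 * p + 2) * (1 / t)"
    proof (intro mult_left_mono)
      have "(\<Sum>i = cutoff+1..D. 1 / (real i)\<^sup>2) \<le> 1 / real cutoff"
        using cutoff(3) t_ge_1 by (intro sum_inverse_square_tail_le) linarith
      also have "\<dots> \<le> 1 / t" using cutoff(3) t_pos by (intro divide_left_mono) auto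
      finally show "(\<Sum>i = cutoff+1..D. 1 / (real i)\<^sup>2) \<le> 1 / t" .
    qed (use late in auto)
    also have "\<dots> = late_const * t powr (2 * p + 1)"
      using t_pos by (simp add: powr_add power2_eq_square)
    finally show ?thesis by (simp add: algebra_simps)
  qed
  ultimately show ?thesis by (rule mean_le_mono[OF _ order_refl])
qed

section \<open>The risk at the stopping index\<close>

lemma sq_dist_tsvd_le:
  assumes "m \<le> D"
  shows "sq_dist D (tsvd_estimator D lam m (observation D lam \<delta> \<mu> \<epsilon>)) \<mu>
    \<le> (\<Sum>i = m+1..D. (\<mu> i)\<^sup>2) + CA\<^sup>2 * \<delta>\<^sup>2 * noise_up_to m \<epsilon>"
proof -
  let ?e = "tsvd_estimator D lam m (observation D lam \<delta> \<mu> \<epsilon>)"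
  have "sq_dist D ?e \<mu> = (\<Sum>i = 1..D. (?e i - \<mu> i)\<^sup>2)"
    by (simp add: sq_dist_def L2_set_def sum_nonneg)
  also have "\<dots> \<le> (\<Sum>i = 1..D. (if m < i then (\<mu> i)\<^sup>2 else 0)
      + CA\<^sup>2 * \<delta>\<^sup>2 * (real i powr (2 * p) * (if i \<le> m then (\<epsilon> i)\<^sup>2 else 0)))"
  proof (rule sum_mono)
    fix i assume i: "i \<in> {1..D}"
    show "(?e i - \<mu> i)\<^sup>2 \<le> (if m < i then (\<mu> i)\<^sup>2 else 0)
      + CA\<^sup>2 * \<delta>\<^sup>2 * (real i powr (2 * p) * (if i \<le> m then (\<epsilon> i)\<^sup>2 else 0))"
    proof (cases "i \<le> m")
      case True
      have "?e i - \<mu> i = inverse (lam i) * (\<delta> * \<epsilon> i)"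
        using i True lam_pos[OF i] by (simp add: tsvd_estimator_def observation_def field_simps)
      then have "(?e i - \<mu> i)\<^sup>2 = (inverse (lam i))\<^sup>2 * (\<delta>\<^sup>2 * (\<epsilon> i)\<^sup>2)"
        by (simp only: power_mult_distrib)
      also have "\<dots> \<le> CA\<^sup>2 * real i powr (2 * p) * (\<delta>\<^sup>2 * (\<epsilon> i)\<^sup>2)"
        by (intro mult_right_mono inverse_lam_square_le i) auto
      finally show ?thesis using True by (simp add: mult_ac)
    qed (use i in \<open>simp add: tsvd_estimator_def\<close>)
  qed
  also have "\<dots> = (\<Sum>i = 1..D. if m < i then (\<mu> i)\<^sup>2 else 0) + CA\<^sup>2 * \<delta>\<^sup>2 * noise_up_to m \<epsilon>"
    by (simp add: sum.distrib sum_distrib_left noise_up_to_def)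
  also have "(\<Sum>i = 1..D. if m < i then (\<mu> i)\<^sup>2 else 0) = (\<Sum>i = m+1..D. (\<mu> i)\<^sup>2)"
    by (subst sum.inter_filter[symmetric]) (auto intro!: sum.cong)
  finally show ?thesis .
qed

lemma stopped_risk_le:
  assumes m\<^sub>0: "m\<^sub>0 = nat \<lfloor>sqrt (real D)\<rfloor> + 1"
  shows "expectation_under D lam \<delta> \<mu>
      (\<lambda>Y. sq_dist D (tsvd_estimator D lam (stopping_index D m\<^sub>0 \<kappa> Y) Y) \<mu>)
    \<le> ennreal ((1 + CA\<^sup>2 * 2 powr (2 * p) * (144 + 2 * Ck)
        + CA\<^sup>2 * (8 * (3 * (2 * CA\<^sup>2 + Ck)) powr (2 * p + 1) + 33 * (512 * (p + 1)) powr (p + 1)))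
      * (\<delta>\<^sup>2 * t powr (2 * p + 1)))"
proof -
  define Y where "Y = observation D lam \<delta> \<mu>"
  define \<tau> where "\<tau> \<epsilon> = stopping_index D m\<^sub>0 \<kappa> (Y \<epsilon>)" for \<epsilon>
  have "sqrt (real D) < real D"
    using D by (intro real_less_lsqrt) (auto simp: power2_eq_square)
  then have "\<lfloor>sqrt (real D)\<rfloor> < int D" by (simp add: floor_less_iff)
  then have m\<^sub>0_le: "m\<^sub>0 \<le> D" using m\<^sub>0 D by (simp add: Suc_le_eq nat_less_iff)
  have "real m\<^sub>0 \<le> sqrt (real D) + 1" using m\<^sub>0 by (simp add: floor_le_iff)
  then have m\<^sub>0_cutoff: "m\<^sub>0 \<le> cutoff" using t(1) t_ge_1 cutoff(3) by linarith
  have res: "residual_sq D m (Y \<epsilon>) \<le> \<kappa> \<longleftrightarrow> residual m \<epsilon> \<le> \<kappa> / \<delta>\<^sup>2" for m \<epsilon>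
    using \<delta> by (simp add: Y_def residual_sq_observation pos_le_divide_eq mult.commute)
  have \<tau>: "\<tau> \<epsilon> \<le> D" "residual (\<tau> \<epsilon>) \<epsilon> \<le> \<kappa> / \<delta>\<^sup>2"
      "m\<^sub>0 \<le> m \<Longrightarrow> m < \<tau> \<epsilon> \<Longrightarrow> \<kappa> / \<delta>\<^sup>2 < residual m \<epsilon>" for m \<epsilon>
    using stopping_index_props[OF m\<^sub>0_le \<kappa>(1), where Y = "Y \<epsilon>"] res[of _ \<epsilon>]
    unfolding \<tau>_def by (auto simp: not_le[symmetric])
  let ?A = "CA\<^sup>2 * real effective_dim powr (2 * p) * \<delta>\<^sup>2"
  let ?v = "8 * (3 * overshoot_const) powr (2 * p + 1) + late_const"
  have "mean_le D (\<lambda>\<epsilon>. sq_dist D (tsvd_estimator D lam (\<tau> \<epsilon>) (Y \<epsilon>)) \<mu>)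
      (\<delta>\<^sup>2 * t powr (2 * p + 1) + ?A * ((144 + 2 * Ck) * t) + CA\<^sup>2 * \<delta>\<^sup>2 * (?v * t powr (2 * p + 1)))"
  proof (rule mean_le_mono[OF mean_le_add[OF mean_le_add[OF mean_le_const
            mean_le_cmult[OF mean_le_undershoot_energy]]
          mean_le_cmult[OF mean_le_stopped_noise[OF m\<^sub>0_cutoff \<tau>(3)]]]])
    fix \<epsilon>
    show "sq_dist D (tsvd_estimator D lam (\<tau> \<epsilon>) (Y \<epsilon>)) \<mu>
      \<le> \<delta>\<^sup>2 * t powr (2 * p + 1) + ?A * undershoot_energy \<epsilon>
        + CA\<^sup>2 * \<delta>\<^sup>2 * noise_up_to (\<tau> \<epsilon>) \<epsilon>"
      using sq_dist_tsvd_le[OF \<tau>(1), of \<epsilon>] bias_le[OF \<tau>(1,2)] unfolding Y_def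
      by (meson add_mono order_refl order_trans)
  qed auto
  then have "mean_le D (\<lambda>\<epsilon>. sq_dist D (tsvd_estimator D lam (\<tau> \<epsilon>) (Y \<epsilon>)) \<mu>)
    ((1 + CA\<^sup>2 * 2 powr (2 * p) * (144 + 2 * Ck)
        + CA\<^sup>2 * (8 * (3 * (2 * CA\<^sup>2 + Ck)) powr (2 * p + 1) + 33 * (512 * (p + 1)) powr (p + 1)))
      * (\<delta>\<^sup>2 * t powr (2 * p + 1)))"
  proof (rule mean_le_mono)
    have "real effective_dim powr (2 * p) \<le> (2 * t) powr (2 * p)"
      using effective_dim(2) p by (intro powr_mono2) auto
    also have "\<dots> = 2 powr (2 * p) * t powr (2 * p)"
      by (rule powr_mult)
    finally have "?A * ((144 + 2 * Ck) * t)
        \<le> CA\<^sup>2 * (2 powr (2 * p) * t powr (2 * p)) * \<delta>\<^sup>2 * ((144 + 2 * Ck) * t)"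
      using Ck t_pos by (intro mult_left_mono mult_right_mono) auto
    also have "\<dots> = CA\<^sup>2 * 2 powr (2 * p) * (144 + 2 * Ck) * (\<delta>\<^sup>2 * t powr (2 * p + 1))"
      using t_pos by (simp add: powr_add)
    finally show "\<delta>\<^sup>2 * t powr (2 * p + 1) + ?A * ((144 + 2 * Ck) * t)
        + CA\<^sup>2 * \<delta>\<^sup>2 * (?v * t powr (2 * p + 1))
      \<le> (1 + CA\<^sup>2 * 2 powr (2 * p) * (144 + 2 * Ck)
        + CA\<^sup>2 * (8 * (3 * (2 * CA\<^sup>2 + Ck)) powr (2 * p + 1) + 33 * (512 * (p + 1)) powr (p + 1)))
      * (\<delta>\<^sup>2 * t powr (2 * p + 1))"
      by (simp add: overshoot_const_def late_const_def algebra_simps)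
  qed simp
  from nn_integral_le_of_mean_le[OF this] show ?thesis
    unfolding expectation_under_def \<tau>_def Y_def .
qed

end

text \<open>
  The factor \<open>R\<close> of the rate is eliminated: what remains of \<open>\<beta>\<close> and \<open>R\<close> is their minimax index.
\<close>

lemma minimax_rate_square_eq:
  assumes "\<delta> > 0" "R > 0" "2 * \<beta> + 2 * p + 1 > 0"
  shows "(minimax_rate \<beta> p R \<delta>)\<^sup>2 = \<delta>\<^sup>2 * minimax_index \<beta> p R \<delta> powr (2 * p + 1)"
    and "R\<^sup>2 = \<delta>\<^sup>2 * minimax_index \<beta> p R \<delta> powr (2 * \<beta> + 2 * p + 1)"
proof -
  define q where "q = 2 * \<beta> + 2 * p + 1"
  define x where "x = inverse R * \<delta>"
  have x: "x > 0" and \<delta>: "\<delta> = R * x" and q: "q > 0"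
    using assms by (auto simp: x_def q_def)
  have "minimax_index \<beta> p R \<delta> = x powr (- 2 / q)" by (simp add: minimax_index_def x_def q_def)
  then have t: "minimax_index \<beta> p R \<delta> powr r = x powr (- 2 * r / q)" for r by (simp add: powr_powr)
  have x2: "x\<^sup>2 = x powr 2" using x by simp
  have "(minimax_rate \<beta> p R \<delta>)\<^sup>2 = R\<^sup>2 * x powr (2 * (2 * \<beta> / q))"
    unfolding minimax_rate_def x_def[symmetric] q_def[symmetric] power_mult_distrib
    using x by (subst powr_power) simp_all
  moreover have "2 + - 2 * (2 * p + 1) / q = 2 * (2 * \<beta> / q)"
    using q by (simp add: field_simps) (simp add: q_def)
  ultimately show "(minimax_rate \<beta> p R \<delta>)\<^sup>2 = \<delta>\<^sup>2 * minimax_index \<beta> p R \<delta> powr (2 * p + 1)"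
    unfolding t by (simp only: \<delta> power_mult_distrib x2 mult.assoc powr_add[symmetric])
  have "2 + - 2 * q / q = 0" using q by simp
  then show "R\<^sup>2 = \<delta>\<^sup>2 * minimax_index \<beta> p R \<delta> powr (2 * \<beta> + 2 * p + 1)"
    unfolding t q_def[symmetric] using x
    by (simp only: \<delta> power_mult_distrib x2 mult.assoc powr_add[symmetric]) simp
qed

theorem corollary3p10:
  fixes p C\<^sub>A C\<^sub>\<kappa> :: real
  assumes "p \<ge> 0" and "C\<^sub>A \<ge> 1" and "C\<^sub>\<kappa> \<ge> 0"
  shows "\<exists>C > 0. \<forall>(D::nat) (\<delta>::real) (lam :: nat \<Rightarrow> real) (\<kappa>::real) (m\<^sub>0::nat).
    D \<ge> 2 \<longrightarrow> \<delta> > 0 \<longrightarrow>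
    antimono_on {1..D} lam \<longrightarrow> lam D > 0 \<longrightarrow>
    (\<forall>i\<in>{1..D}. inverse C\<^sub>A * real i powr (- p) \<le> lam i \<and> lam i \<le> C\<^sub>A * real i powr (- p)) \<longrightarrow>
    \<kappa> > 0 \<longrightarrow> \<bar>\<kappa> - real D * \<delta>\<^sup>2\<bar> \<le> C\<^sub>\<kappa> * sqrt (real D) * \<delta>\<^sup>2 \<longrightarrow>
    m\<^sub>0 = nat \<lfloor>sqrt (real D)\<rfloor> + 1 \<longrightarrow>
    (\<forall>\<beta> R. \<beta> \<ge> 0 \<longrightarrow> R > 0 \<longrightarrow> minimax_index \<beta> p R \<delta> \<in> {sqrt (real D)..real D} \<longrightarrow>
      (SUP \<mu>\<in>sobolev_ellipsoid \<beta> R D.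
         expectation_under D lam \<delta> \<mu>
           (\<lambda>Y. sq_dist D (tsvd_estimator D lam (stopping_index D m\<^sub>0 \<kappa> Y) Y) \<mu>))
      \<le> ennreal (C * (minimax_rate \<beta> p R \<delta>)\<^sup>2))"
proof -
  define C where "C = 1 + C\<^sub>A\<^sup>2 * 2 powr (2 * p) * (144 + 2 * C\<^sub>\<kappa>)
    + C\<^sub>A\<^sup>2 * (8 * (3 * (2 * C\<^sub>A\<^sup>2 + C\<^sub>\<kappa>)) powr (2 * p + 1) + 33 * (512 * (p + 1)) powr (p + 1))"
  have "C > 0"
    unfolding C_def using assms by (intro add_pos_nonneg add_nonneg_nonneg mult_nonneg_nonneg) auto
  moreover have "(SUP \<mu>\<in>sobolev_ellipsoid \<beta> R D.
         expectation_under D lam \<delta> \<mu>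
           (\<lambda>Y. sq_dist D (tsvd_estimator D lam (stopping_index D m\<^sub>0 \<kappa> Y) Y) \<mu>))
      \<le> ennreal (C * (minimax_rate \<beta> p R \<delta>)\<^sup>2)"
    if "D \<ge> 2" "\<delta> > 0"
      and lam: "\<forall>i\<in>{1..D}. inverse C\<^sub>A * real i powr (- p) \<le> lam i \<and> lam i \<le> C\<^sub>A * real i powr (- p)"
      and \<kappa>: "\<kappa> > 0" "\<bar>\<kappa> - real D * \<delta>\<^sup>2\<bar> \<le> C\<^sub>\<kappa> * sqrt (real D) * \<delta>\<^sup>2"
      and m\<^sub>0: "m\<^sub>0 = nat \<lfloor>sqrt (real D)\<rfloor> + 1"
      and "\<beta> \<ge> 0" "R > 0" and t: "minimax_index \<beta> p R \<delta> \<in> {sqrt (real D)..real D}"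
    for D m\<^sub>0 :: nat and \<delta> \<kappa> \<beta> R :: real and lam :: "nat \<Rightarrow> real"
  proof (rule SUP_least)
    fix \<mu> assume \<mu>: "\<mu> \<in> sobolev_ellipsoid \<beta> R D"
    have q: "2 * \<beta> + 2 * p + 1 > 0" using \<open>\<beta> \<ge> 0\<close> assms(1) by simp
    note rate = minimax_rate_square_eq[OF \<open>\<delta> > 0\<close> \<open>R > 0\<close> q]
    interpret sobolev_svd_model D \<delta> \<kappa> p C\<^sub>A C\<^sub>\<kappa> "minimax_index \<beta> p R \<delta>" \<beta> R lam \<mu>
      by unfold_locales (use that assms \<mu> rate(2) in \<open>auto simp: sobolev_ellipsoid_def\<close>)
    show "expectation_under D lam \<delta> \<mu>
        (\<lambda>Y. sq_dist D (tsvd_estimator D lam (stopping_index D m\<^sub>0 \<kappa> Y) Y) \<mu>)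
      \<le> ennreal (C * (minimax_rate \<beta> p R \<delta>)\<^sup>2)"
      using stopped_risk_le[OF m\<^sub>0] by (simp only: rate(1) C_def)
  qed
  ultimately show ?thesis by blast
qed

end
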